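(* Let $S$ be a semigroup and let $\operatorname{Min}(S)$ be the set of all minimal left ideals of $S$. Then: (i) if the intersection ideal graph $\Gamma(S)$ is a perfect graph, then $|\operatorname{Min}(S)|\leq 4$; (ii) if $S$ is the union of $n$ minimal left ideals, then $\Gamma(S)$ is perfect if and only if $n\leq 4$.
   Context: A left ideal of a semigroup $S$ is a non-empty subset $I\subseteq S$ with $SI\subseteq I$; it is nontrivial if $I\neq S$. The intersection of two left ideals is nontrivial if it is non-empty. Minimal left ideals are understood to be nontrivial: a nontrivial left ideal is minimal if it does not properly contain any left ideal of $S$. The intersection ideal graph $\Gamma(S)$ is the simple undirected graph whose vertices are the nontrivial left ideals of $S$, with two distinct vertices $I,J$ adjacent if and only if $I\cap J$ is nontrivial. "Union of $n$ minimal left ideals" means the union of $n$ pairwise distinct minimal left ideals. A graph $\Gamma$ is perfect if $\omega(\Gamma')=\chi(\Gamma')$ for every induced subgraph $\Gamma'$ of $\Gamma$, where $\omega$ is the clique number and $\chi$ the chromatic number. *)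

theory Defs
  imports "HOL-Library.Ramsey" "HOL-Library.Extended_Nat"
begin

definition left_ideal :: "'a::semigroup_mult set \<Rightarrow> bool" where
  "left_ideal I \<longleftrightarrow> I \<noteq> {} \<and> (\<forall>s. \<forall>x\<in>I. s * x \<in> I)"

definition nontrivial_left_ideal :: "'a::semigroup_mult set \<Rightarrow> bool" where
  "nontrivial_left_ideal I \<longleftrightarrow> left_ideal I \<and> I \<noteq> UNIV"

definition minimal_left_ideal :: "'a::semigroup_mult set \<Rightarrow> bool" where
  "minimal_left_ideal I \<longleftrightarrow> nontrivial_left_ideal I \<and> (\<nexists>J. left_ideal J \<and> J \<subset> I)"

definition minimal_left_ideals :: "'a::semigroup_mult set set" where
  "minimal_left_ideals = {I. minimal_left_ideal I}"

text \<open>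
  A simple undirected graph, possibly infinite, is a pair \<open>(V, E)\<close> of a vertex set and a set of
  two-element subsets of \<open>V\<close>, as in the notion \<^const>\<open>clique\<close> of the library.
\<close>

type_synonym 'v graph = "'v set \<times> 'v set set"

definition induced_subgraph :: "'v graph \<Rightarrow> 'v set \<Rightarrow> 'v graph" where
  "induced_subgraph G W = (W, {e \<in> snd G. e \<subseteq> W})"

text \<open>
  Both invariants take the value \<open>\<infinity>\<close> when they are not finite. An infinite clique contains finite
  cliques of every size, so the supremum over the finite cliques suffices.
\<close>

definition clique_number :: "'v graph \<Rightarrow> enat" where
  "clique_number G = (SUP K \<in> {K. K \<subseteq> fst G \<and> finite K \<and> clique K (snd G)}. enat (card K))"

definition colorable :: "'v graph \<Rightarrow> nat \<Rightarrow> bool" where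
  "colorable G k \<longleftrightarrow>
    (\<exists>c. c ` fst G \<subseteq> {..<k} \<and> (\<forall>v\<in>fst G. \<forall>w\<in>fst G. {v, w} \<in> snd G \<longrightarrow> c v \<noteq> c w))"

definition chromatic_number :: "'v graph \<Rightarrow> enat" where
  "chromatic_number G = (INF k \<in> {k. colorable G k}. enat k)"

definition perfect_graph :: "'v graph \<Rightarrow> bool" where
  "perfect_graph G \<longleftrightarrow>
    (\<forall>W \<subseteq> fst G. clique_number (induced_subgraph G W) = chromatic_number (induced_subgraph G W))"

definition intersection_ideal_graph :: "'a::semigroup_mult set graph" where
  "intersection_ideal_graph =
    ({I. nontrivial_left_ideal I},
     {{I, J} | I J. nontrivial_left_ideal I \<and> nontrivial_left_ideal J \<and> I \<noteq> J \<and> I \<inter> J \<noteq> {}})"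

definition union_of_minimal_left_ideals :: "'a::semigroup_mult itself \<Rightarrow> nat \<Rightarrow> bool" where
  "union_of_minimal_left_ideals _ n \<longleftrightarrow>
    (\<exists>M :: 'a set set. M \<subseteq> minimal_left_ideals \<and> finite M \<and> card M = n \<and> \<Union>M = UNIV)"

end

theory Submission
  imports Defs
begin

text \<open>
  Distinct minimal left ideals are disjoint, so five of them give an induced 5-cycle formed by the
  unions of cyclically consecutive ones; it has clique number 2 but is not 2-colourable.

  Conversely, let \<open>S\<close> be a union of at most four minimal left ideals and let \<open>W\<close> be a set of
  nontrivial left ideals. Two disjoint non-minimal left ideals are then complementary, so the
  non-minimal members of \<open>W\<close> are optimally coloured by the classes \<open>{A, -A}\<close>. If every minimal \<open>T \<in> W\<close>
  is disjoint from some non-minimal \<open>A \<in> W\<close> such that \<open>-A\<close> is not a non-minimal member of \<open>W\<close>, then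
  \<open>T\<close> can share the colour of \<open>A\<close>.
  Otherwise one extra colour suffices for all the minimal members, and it is necessary:
  each class has a member containing the exceptional \<open>T\<close>.
\<close>

section \<open>Clique number and chromatic number\<close>

text \<open>Colours may thus be drawn from any finite set, such as the classes
  \<open>{A, - A}\<close> below; a bijection onto an initial segment of the naturals renames
  them.\<close>

lemma colorable_card:
  assumes "finite X" "c ` fst G \<subseteq> X"
    and "\<And>v w. v \<in> fst G \<Longrightarrow> w \<in> fst G \<Longrightarrow> {v, w} \<in> snd G \<Longrightarrow> c v \<noteq> c w"
  shows "colorable G (card X)"
proof -
  obtain h where h: "bij_betw h X {..<card X}"
    using ex_bij_betw_finite_nat[OF assms(1)] by (auto simp: atLeast0LessThan)
  have "(h \<circ> c) ` fst G \<subseteq> {..<card X}"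
    using h assms(2) by (auto simp: bij_betw_def)
  moreover have "(h \<circ> c) v \<noteq> (h \<circ> c) w"
    if "v \<in> fst G" "w \<in> fst G" "{v, w} \<in> snd G" for v w
  proof -
    have "c v \<in> X" "c w \<in> X" using that assms(2) by blast+
    then show ?thesis
      using assms(3)[OF that] h by (auto simp: bij_betw_def inj_on_def)
  qed
  ultimately show ?thesis unfolding colorable_def by blast
qed

lemma clique_card_le_colorable:
  assumes "K \<subseteq> fst G" "clique K (snd G)" "colorable G k"
  shows "card K \<le> k"
proof -
  obtain c where c: "c ` fst G \<subseteq> {..<k}"
    and cne: "\<forall>v\<in>fst G. \<forall>w\<in>fst G. {v, w} \<in> snd G \<longrightarrow> c v \<noteq> c w"
    using assms(3) unfolding colorable_def by blast
  have "inj_on c K"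
  proof (rule inj_onI)
    fix v w assume vw: "v \<in> K" "w \<in> K" and eq: "c v = c w"
    have "{v, w} \<notin> snd G" using vw eq cne assms(1) by blast
    then show "v = w" using vw assms(2) unfolding clique_def by blast
  qed
  moreover have "c ` K \<subseteq> {..<k}" using assms(1) c by blast
  ultimately show ?thesis using card_inj_on_le[of c K "{..<k}"] by simp
qed

text \<open>A clique and a proper colouring of the same size certify that both are optimal.\<close>

lemma clique_number_eq_chromatic_number:
  assumes "K \<subseteq> fst G" "finite K" "clique K (snd G)" "colorable G (card K)"
  shows "clique_number G = chromatic_number G"
proof (rule antisym)
  show "clique_number G \<le> chromatic_number G"
    unfolding clique_number_def chromatic_number_def
    by (rule SUP_least, rule INF_greatest) (auto intro: clique_card_le_colorable)
  have "chromatic_number G \<le> enat (card K)"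
    unfolding chromatic_number_def using assms(4) by (auto intro: INF_lower)
  also have "\<dots> \<le> clique_number G"
    unfolding clique_number_def using assms(1-3) by (auto intro!: SUP_upper)
  finally show "chromatic_number G \<le> clique_number G" .
qed

text \<open>The five non-edges form the complementary 5-cycle \<open>v1\<close>, \<open>v3\<close>,
  \<open>v5\<close>, \<open>v2\<close>, \<open>v4\<close>. A clique omits an end of each of them,
  provided the ends are distinct, and this confines it to two consecutive vertices of the original
  cycle.\<close>

lemma clique_subset_5_cycle:
  assumes K: "K \<subseteq> {v1, v2, v3, v4, v5}" "clique K E"
    and d: "v1 \<noteq> v3" "v3 \<noteq> v5" "v5 \<noteq> v2" "v2 \<noteq> v4" "v4 \<noteq> v1"
    and n: "{v1, v3} \<notin> E" "{v3, v5} \<notin> E" "{v5, v2} \<notin> E" "{v2, v4} \<notin> E" "{v4, v1} \<notin> E"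
  shows "card K \<le> 2"
proof -
  have nc: "v1 \<notin> K \<or> v3 \<notin> K" "v3 \<notin> K \<or> v5 \<notin> K" "v5 \<notin> K \<or> v2 \<notin> K"
    "v2 \<notin> K \<or> v4 \<notin> K" "v4 \<notin> K \<or> v1 \<notin> K"
    using K(2) d n unfolding clique_def by blast+
  have sub:
    "v3 \<in> K \<or> v4 \<in> K \<or> v5 \<in> K \<or> K \<subseteq> {v1, v2}"
    "v4 \<in> K \<or> v5 \<in> K \<or> v1 \<in> K \<or> K \<subseteq> {v2, v3}"
    "v5 \<in> K \<or> v1 \<in> K \<or> v2 \<in> K \<or> K \<subseteq> {v3, v4}"
    "v1 \<in> K \<or> v2 \<in> K \<or> v3 \<in> K \<or> K \<subseteq> {v4, v5}"
    "v2 \<in> K \<or> v3 \<in> K \<or> v4 \<in> K \<or> K \<subseteq> {v5, v1}"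
    using K(1) by blast+
  have "K \<subseteq> {v1, v2} \<or> K \<subseteq> {v2, v3} \<or> K \<subseteq> {v3, v4} \<or> K \<subseteq> {v4, v5} \<or> K \<subseteq> {v5, v1}"
    using nc sub by metis
  then obtain x y where "K \<subseteq> {x, y}" by blast
  then have "card K \<le> card {x, y}" by (intro card_mono) auto
  also have "\<dots> \<le> 2" by (simp add: card_insert_if)
  finally show ?thesis .
qed

lemma not_perfect_5_cycle:
  assumes V: "{v1, v2, v3, v4, v5} \<subseteq> fst G"
    and d: "v1 \<noteq> v3" "v3 \<noteq> v5" "v5 \<noteq> v2" "v2 \<noteq> v4" "v4 \<noteq> v1"
    and e: "{v1, v2} \<in> snd G" "{v2, v3} \<in> snd G" "{v3, v4} \<in> snd G" "{v4, v5} \<in> snd G"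
      "{v5, v1} \<in> snd G"
    and n: "{v1, v3} \<notin> snd G" "{v3, v5} \<notin> snd G" "{v5, v2} \<notin> snd G" "{v2, v4} \<notin> snd G"
      "{v4, v1} \<notin> snd G"
  shows "\<not> perfect_graph G"
proof
  assume perf: "perfect_graph G"
  define H where "H = induced_subgraph G {v1, v2, v3, v4, v5}"
  have fH: "fst H = {v1, v2, v3, v4, v5}" and sH: "snd H \<subseteq> snd G"
    by (auto simp: H_def induced_subgraph_def)
  have eH: "{v1, v2} \<in> snd H" "{v2, v3} \<in> snd H" "{v3, v4} \<in> snd H" "{v4, v5} \<in> snd H"
      "{v5, v1} \<in> snd H"
    using e by (auto simp: H_def induced_subgraph_def)
  have "card K \<le> 2" if "K \<subseteq> fst H" "clique K (snd H)" for K
    using clique_subset_5_cycle[of K v1 v2 v3 v4 v5 "snd H"] that d n sH fH by blast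
  then have "clique_number H \<le> enat 2"
    unfolding clique_number_def by (intro SUP_least) auto
  moreover have "clique_number H = chromatic_number H"
    using perf V unfolding perfect_graph_def H_def by blast
  ultimately have "chromatic_number H < enat 3"
    using order_le_less_trans[of _ "enat 2" "enat 3"] by simp
  then obtain k where k: "colorable H k" "k < 3"
    unfolding chromatic_number_def by (auto simp: INF_less_iff)
  then obtain c where c: "c ` fst H \<subseteq> {..<k}"
    and cne: "\<forall>v\<in>fst H. \<forall>w\<in>fst H. {v, w} \<in> snd H \<longrightarrow> c v \<noteq> c w"
    unfolding colorable_def by blast
  have "c v < 2" if "v \<in> fst H" for v
    using c k(2) that by fastforce
  then have lt: "c v1 < 2" "c v2 < 2" "c v3 < 2" "c v4 < 2" "c v5 < 2"
    by (simp_all add: fH)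
  have ne: "c v1 \<noteq> c v2" "c v2 \<noteq> c v3" "c v3 \<noteq> c v4" "c v4 \<noteq> c v5" "c v5 \<noteq> c v1"
    using cne eH unfolding fH by blast+
  \<comment> \<open>With only two colours available, colours alternate along the path from
    \<open>v1\<close> to \<open>v5\<close>, so the adjacent ends \<open>v5\<close> and
    \<open>v1\<close> would agree.\<close>
  have "c v3 = c v1" using lt(1-3) ne(1,2) by linarith
  moreover have "c v5 = c v3" using lt(3-5) ne(3,4) by linarith
  ultimately show False using ne(5) by simp
qed

section \<open>Families in which disjoint large sets are complementary\<close>

text \<open>Here \<open>L\<close> and \<open>N\<close> abstract the non-minimal and the minimal
  members of a vertex set. The clique \<open>K\<close> and the colour set \<open>X\<close> have
  equal size, as needed to certify that the clique and chromatic numbers coincide.\<close>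

lemma optimal_intersection_coloring:
  fixes L N :: "'a set set"
  assumes fin: "finite L"
    and ne: "{} \<notin> L" "{} \<notin> N"
    and L: "\<And>A B. A \<in> L \<Longrightarrow> B \<in> L \<Longrightarrow> A \<inter> B = {} \<Longrightarrow> B = - A"
    and N: "\<And>A B. A \<in> N \<Longrightarrow> B \<in> N \<Longrightarrow> A \<noteq> B \<Longrightarrow> A \<inter> B = {}"
    and LN: "\<And>A T. A \<in> L \<Longrightarrow> T \<in> N \<Longrightarrow> T \<subseteq> A \<or> A \<inter> T = {}"
  obtains K X and c :: "'a set \<Rightarrow> 'a set set"
  where "K \<subseteq> L \<union> N" "finite K" "pairwise (\<lambda>A B. A \<inter> B \<noteq> {}) K"
    "finite X" "c ` (L \<union> N) \<subseteq> X" "card X = card K"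
    "\<And>A B. A \<in> L \<union> N \<Longrightarrow> B \<in> L \<union> N \<Longrightarrow> A \<noteq> B \<Longrightarrow> A \<inter> B \<noteq> {} \<Longrightarrow> c A \<noteq> c B"
proof -
  define r where "r A = {A, - A}" for A :: "'a set"
  \<comment> \<open>A transversal of the classes \<open>{A, - A}\<close> met by \<open>L\<close>: if
    both sets are in \<open>L\<close> the one containing \<open>t\<close> is chosen, otherwise the
    only one present.\<close>
  define C where "C t = {A \<in> L. t \<in> A \<or> - A \<notin> L}" for t
  have r_eq: "B = A \<or> B = - A" if "r A = r B" for A B
    using that unfolding r_def by (auto simp: doubleton_eq_iff)
  have r_compl: "r (- A) = r A" for A
    unfolding r_def by auto
  have CL: "C t \<subseteq> L" and finC: "finite (C t)" for t
    using fin by (auto simp: C_def)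
  have "inj_on r (C t)" for t
  proof (rule inj_onI)
    fix A B assume "A \<in> C t" "B \<in> C t" "r A = r B"
    then show "A = B" using r_eq[of A B] by (auto simp: C_def)
  qed
  moreover have rC: "r ` C t = r ` L" for t
  proof
    show "r ` L \<subseteq> r ` C t"
    proof
      fix y assume "y \<in> r ` L"
      then obtain A where A: "A \<in> L" "y = r A" by blast
      show "y \<in> r ` C t"
      proof (cases "A \<in> C t")
        case False
        then have "- A \<in> C t" using A(1) by (auto simp: C_def)
        then show ?thesis using A(2) r_compl[of A] by (metis imageI)
      qed (use A in blast)
    qed
  qed (use CL in blast)
  ultimately have cardC: "card (C t) = card (r ` L)" for t
    by (metis card_image)
  \<comment> \<open>Disjoint members would be complementary with both in \<open>L\<close>, so
    \<open>t\<close> would have to lie in both.\<close>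
  have pairC: "pairwise (\<lambda>A B. A \<inter> B \<noteq> {}) (C t)" for t
    unfolding pairwise_def
  proof (intro ballI impI notI)
    fix A B assume "A \<in> C t" "B \<in> C t" "A \<inter> B = {}"
    moreover from this have "B = - A" using L CL by blast
    ultimately show False by (auto simp: C_def)
  qed
  have rL: "r A \<noteq> r B" if "A \<in> L" "B \<in> L" "A \<noteq> B" "A \<inter> B \<noteq> {}" for A B
    using r_eq[of A B] that by auto
  show thesis
  \<comment> \<open>In the first case every member of \<open>C t\<close> contains \<open>t\<close>,
    so \<open>T\<close> extends this clique by one.\<close>
  proof (cases "\<exists>T\<in>N - L. \<exists>t\<in>T. \<forall>A\<in>L. t \<notin> A \<longrightarrow> - A \<in> L")
    case True
    then obtain T t where T: "T \<in> N" "T \<notin> L" "t \<in> T" "\<And>A. A \<in> L \<Longrightarrow> t \<notin> A \<Longrightarrow> - A \<in> L"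
      by blast
    have tC: "t \<in> A" if "A \<in> C t" for A
      using that T(4) by (auto simp: C_def)
    show thesis
    \<comment> \<open>The colour \<open>{}\<close> is new because \<open>r A\<close> is never empty;
      all of \<open>N - L\<close> can share it, being pairwise disjoint.\<close>
    proof (rule that[of "insert T (C t)" "insert {} (r ` L)" "\<lambda>A. if A \<in> L then r A else {}"])
      show "pairwise (\<lambda>A B. A \<inter> B \<noteq> {}) (insert T (C t))"
        using pairC T(3) tC by (auto simp: pairwise_insert)
      have "T \<notin> C t" "{} \<notin> r ` L" using T(2) by (auto simp: C_def r_def)
      then show "card (insert {} (r ` L)) = card (insert T (C t))"
        using fin finC cardC by simp
      show "(if A \<in> L then r A else {}) \<noteq> (if B \<in> L then r B else {})"
        if "A \<in> L \<union> N" "B \<in> L \<union> N" "A \<noteq> B" "A \<inter> B \<noteq> {}" for A B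
        using that rL[of A B] N[of A B] by (auto simp: r_def)
    qed (use T CL fin finC in auto)
  next
    case False
    \<comment> \<open>Any point of \<open>T\<close> is missed by some \<open>A\<close> in
      \<open>L\<close> without a complement in \<open>L\<close>; missing one point of
      \<open>T\<close>, this \<open>A\<close> misses all of \<open>T\<close> by
      \<open>LN\<close>.\<close>
    have "\<exists>A\<in>L. A \<inter> T = {} \<and> - A \<notin> L" if T: "T \<in> N - L" for T
    proof -
      have "T \<noteq> {}" using T ne(2) by auto
      then obtain t where t: "t \<in> T" by blast
      with False T obtain A where "A \<in> L" "t \<notin> A" "- A \<notin> L" by blast
      then show ?thesis using LN[of A T] T t by blast
    qed
    then obtain f where f: "\<And>T. T \<in> N - L \<Longrightarrow> f T \<in> L \<and> f T \<inter> T = {} \<and> - f T \<notin> L"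
      by metis
    \<comment> \<open>Only \<open>f T\<close> and its complement have this colour: the former is
      disjoint from \<open>T\<close>, the latter is not in \<open>L\<close>.\<close>
    have rf: "r A \<noteq> r (f T)" if "A \<in> L" "T \<in> N - L" "A \<inter> T \<noteq> {}" for A T
      using r_eq[of "f T" A] that f[of T] by auto
    show thesis
    \<comment> \<open>Every \<open>C t\<close> is a clique with one member per class, so the choice
      of \<open>t\<close> is arbitrary here.\<close>
    proof (rule that[of "C undefined" "r ` L" "\<lambda>A. if A \<in> L then r A else r (f A)"])
      show "(if A \<in> L then r A else r (f A)) \<noteq> (if B \<in> L then r B else r (f B))"
        if "A \<in> L \<union> N" "B \<in> L \<union> N" "A \<noteq> B" "A \<inter> B \<noteq> {}" for A B
        using that rL[of A B] N[of A B] rf[of A B] rf[of B A] by (auto simp: Int_commute)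
    qed (use CL fin finC cardC pairC f in auto)
  qed
qed

section \<open>Minimal left ideals\<close>

lemma left_ideal_Un: "left_ideal I \<Longrightarrow> left_ideal J \<Longrightarrow> left_ideal (I \<union> J)"
  unfolding left_ideal_def by auto

lemma left_ideal_Int: "left_ideal I \<Longrightarrow> left_ideal J \<Longrightarrow> I \<inter> J \<noteq> {} \<Longrightarrow> left_ideal (I \<inter> J)"
  unfolding left_ideal_def by auto

lemma minimal_left_ideal_imp_left_ideal: "minimal_left_ideal I \<Longrightarrow> left_ideal I"
  unfolding minimal_left_ideal_def nontrivial_left_ideal_def by blast

text \<open>If non-empty, \<open>J \<inter> I\<close> is a left ideal inside \<open>I\<close>, hence
  equal to \<open>I\<close> by minimality.\<close>

lemma minimal_left_ideal_subset_or_disjoint: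
  assumes "minimal_left_ideal I" "left_ideal J"
  shows "I \<subseteq> J \<or> J \<inter> I = {}"
  using assms left_ideal_Int[of J I] minimal_left_ideal_imp_left_ideal[of I]
  unfolding minimal_left_ideal_def by blast

lemma minimal_left_ideals_disjoint:
  assumes "minimal_left_ideal I" "minimal_left_ideal J" "I \<noteq> J"
  shows "I \<inter> J = {}"
  using assms minimal_left_ideal_subset_or_disjoint minimal_left_ideal_imp_left_ideal
  by (metis Int_commute subset_antisym)

lemma intersection_ideal_graph_edge_iff:
  "{I, J} \<in> snd intersection_ideal_graph \<longleftrightarrow>
    nontrivial_left_ideal I \<and> nontrivial_left_ideal J \<and> I \<noteq> J \<and> I \<inter> J \<noteq> {}"
  unfolding intersection_ideal_graph_def by (auto simp: doubleton_eq_iff)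

section \<open>Unions of two minimal left ideals and the 5-cycle they form\<close>

lemma nontrivial_left_ideal_Un:
  assumes "minimal_left_ideal I" "minimal_left_ideal J" "minimal_left_ideal K"
    and "I \<noteq> K" "J \<noteq> K"
  shows "nontrivial_left_ideal (I \<union> J)"
proof -
  \<comment> \<open>The third ideal \<open>K\<close> stays outside the union and makes it
    proper.\<close>
  have "(I \<union> J) \<inter> K = {}"
    using assms by (simp add: Int_Un_distrib2 minimal_left_ideals_disjoint)
  moreover have "K \<noteq> {}"
    using assms(3) minimal_left_ideal_imp_left_ideal left_ideal_def by blast
  ultimately have "I \<union> J \<noteq> UNIV" by auto
  then show ?thesis
    using assms(1,2) left_ideal_Un minimal_left_ideal_imp_left_ideal
    unfolding nontrivial_left_ideal_def by blast
qed

text \<open>The two unions share \<open>J\<close>, and they differ because \<open>I\<close> is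
  disjoint from the second.\<close>

lemma minimal_left_ideals_Un_adjacent:
  assumes "minimal_left_ideal I" "minimal_left_ideal J" "minimal_left_ideal K"
    and "I \<noteq> J" "I \<noteq> K" "J \<noteq> K"
  shows "{I \<union> J, J \<union> K} \<in> snd intersection_ideal_graph"
proof -
  have "I \<noteq> {}" "J \<noteq> {}"
    using assms minimal_left_ideal_imp_left_ideal left_ideal_def by blast+
  moreover have "I \<inter> (J \<union> K) = {}"
    using assms by (simp add: Int_Un_distrib minimal_left_ideals_disjoint)
  moreover have "nontrivial_left_ideal (I \<union> J)" "nontrivial_left_ideal (J \<union> K)"
    using assms nontrivial_left_ideal_Un by metis+
  ultimately show ?thesis
    unfolding intersection_ideal_graph_edge_iff by blast
qed

lemma minimal_left_ideals_Un_nonadjacent: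
  assumes "minimal_left_ideal I" "minimal_left_ideal J" "minimal_left_ideal K"
    "minimal_left_ideal L"
    and "I \<noteq> K" "I \<noteq> L" "J \<noteq> K" "J \<noteq> L"
  shows "{I \<union> J, K \<union> L} \<notin> snd intersection_ideal_graph"
  using assms
  by (simp add: intersection_ideal_graph_edge_iff Int_Un_distrib Int_Un_distrib2
      minimal_left_ideals_disjoint)

lemma minimal_left_ideals_Un_neq:
  assumes "minimal_left_ideal I" "minimal_left_ideal K" "minimal_left_ideal L"
    and "I \<noteq> K" "I \<noteq> L"
  shows "I \<union> J \<noteq> K \<union> L"
proof
  assume "I \<union> J = K \<union> L"
  moreover have "I \<inter> (K \<union> L) = {}"
    using assms by (simp add: Int_Un_distrib minimal_left_ideals_disjoint)
  ultimately have "I = {}" by blast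
  then show False
    using assms(1) minimal_left_ideal_imp_left_ideal left_ideal_def by blast
qed

lemma not_perfect_if_5_minimal_left_ideals:
  fixes D :: "'a::semigroup_mult set set"
  assumes "D \<subseteq> minimal_left_ideals" "card D = 5"
  shows "\<not> perfect_graph (intersection_ideal_graph :: 'a set graph)"
proof -
  have "finite D" using assms(2) by (simp add: card_ge_0_finite)
  then obtain xs where xs: "set xs = D" "distinct xs"
    using finite_distinct_list by blast
  then have "length xs = Suc (Suc (Suc (Suc (Suc 0))))"
    using assms(2) distinct_card[of xs] by simp
  then obtain a b c d e where "xs = [a, b, c, d, e]"
    by (auto simp: length_Suc_conv)
  with xs have D: "D = {a, b, c, d, e}" and dist: "distinct [a, b, c, d, e]" by simp_all
  have neq: "a \<noteq> b" "a \<noteq> c" "a \<noteq> d" "a \<noteq> e" "b \<noteq> c" "b \<noteq> d" "b \<noteq> e" "c \<noteq> d" "c \<noteq> e" "d \<noteq> e"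
    using dist by simp_all
  have m: "minimal_left_ideal a" "minimal_left_ideal b" "minimal_left_ideal c"
      "minimal_left_ideal d" "minimal_left_ideal e"
    using assms(1) unfolding D minimal_left_ideals_def by simp_all
  show ?thesis
  proof (rule not_perfect_5_cycle[of "a \<union> b" "b \<union> c" "c \<union> d" "d \<union> e" "e \<union> a"])
    have "nontrivial_left_ideal (a \<union> b)" "nontrivial_left_ideal (b \<union> c)"
        "nontrivial_left_ideal (c \<union> d)" "nontrivial_left_ideal (d \<union> e)"
        "nontrivial_left_ideal (e \<union> a)"
      by (rule nontrivial_left_ideal_Un[of a b c] nontrivial_left_ideal_Un[of b c d]
          nontrivial_left_ideal_Un[of c d e] nontrivial_left_ideal_Un[of d e a]
          nontrivial_left_ideal_Un[of e a b]; simp add: m neq neq[symmetric])+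
    then show "{a \<union> b, b \<union> c, c \<union> d, d \<union> e, e \<union> a} \<subseteq> fst intersection_ideal_graph"
      by (simp add: intersection_ideal_graph_def)
  qed (rule minimal_left_ideals_Un_adjacent minimal_left_ideals_Un_nonadjacent
      minimal_left_ideals_Un_neq; simp add: m neq neq[symmetric])+
qed

text \<open>Finiteness is stated separately because \<open>card\<close> is 0 on infinite sets. An
  infinite set, like one with more than four elements, has a five-element subset.\<close>

lemma perfect_imp_card_minimal_left_ideals_le_4:
  assumes "perfect_graph (intersection_ideal_graph :: 'a::semigroup_mult set graph)"
  shows "finite (minimal_left_ideals :: 'a set set)"
    and "card (minimal_left_ideals :: 'a set set) \<le> 4"
proof -
  have no5: "\<nexists>D :: 'a set set. D \<subseteq> minimal_left_ideals \<and> card D = 5"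
    using assms not_perfect_if_5_minimal_left_ideals by blast
  then show "finite (minimal_left_ideals :: 'a set set)"
    using infinite_arbitrarily_large by metis
  show "card (minimal_left_ideals :: 'a set set) \<le> 4"
  proof (rule ccontr)
    assume "\<not> card (minimal_left_ideals :: 'a set set) \<le> 4"
    then have "5 \<le> card (minimal_left_ideals :: 'a set set)" by simp
    then show False using no5 obtain_subset_with_card_n by metis
  qed
qed

section \<open>Semigroups that are a union of at most four minimal left ideals\<close>

context
  fixes M :: "'a::semigroup_mult set set"
  assumes minimal: "M \<subseteq> minimal_left_ideals"
    and finite_M: "finite M"
    and card_M: "card M \<le> 4"
    and Union_M: "\<Union>M = UNIV"
begin

text \<open>Each point of \<open>A\<close> lies in some member of \<open>M\<close>, which meets
  \<open>A\<close> and is therefore contained in it.\<close>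

lemma left_ideal_eq_Union:
  assumes "left_ideal A"
  shows "A = \<Union>{K \<in> M. K \<subseteq> A}"
proof -
  have "\<exists>K\<in>M. K \<subseteq> A \<and> x \<in> K" if "x \<in> A" for x
  proof -
    obtain K where K: "K \<in> M" "x \<in> K" using Union_M by blast
    then show ?thesis
      using minimal_left_ideal_subset_or_disjoint[of K A] assms minimal that
      by (auto simp: minimal_left_ideals_def)
  qed
  then show ?thesis by blast
qed

lemma finite_left_ideals: "finite {A :: 'a set. left_ideal A}"
proof (rule finite_subset)
  show "{A :: 'a set. left_ideal A} \<subseteq> Union ` Pow M"
    using left_ideal_eq_Union by fastforce
qed (simp add: finite_M)

text \<open>With no component \<open>A\<close> would be empty, and with a single one it would be
  minimal.\<close>

lemma two_le_card_components:
  assumes "left_ideal A" "\<not> minimal_left_ideal A"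
  shows "2 \<le> card {K \<in> M. K \<subseteq> A}"
proof (rule ccontr)
  assume "\<not> ?thesis"
  then have "card {K \<in> M. K \<subseteq> A} = 0 \<or> card {K \<in> M. K \<subseteq> A} = 1" by linarith
  then show False
  proof
    assume "card {K \<in> M. K \<subseteq> A} = 0"
    then have "{K \<in> M. K \<subseteq> A} = {}" using finite_M by auto
    then have "A = {}" using left_ideal_eq_Union[OF assms(1)] by auto
    then show False using assms(1) by (simp add: left_ideal_def)
  next
    assume "card {K \<in> M. K \<subseteq> A} = 1"
    then obtain K where K: "{K \<in> M. K \<subseteq> A} = {K}" by (auto simp: card_1_singleton_iff)
    then have "A = K" using left_ideal_eq_Union[OF assms(1)] by simp
    then show False using K minimal assms(2) by (auto simp: minimal_left_ideals_def)
  qed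
qed

lemma disjoint_nonminimal_complementary:
  fixes A B :: "'a set"
  assumes A: "left_ideal A" "\<not> minimal_left_ideal A"
    and B: "left_ideal B" "\<not> minimal_left_ideal B"
    and disj: "A \<inter> B = {}"
  shows "B = - A"
proof -
  let ?c = "\<lambda>A. {K \<in> M. K \<subseteq> A}"
  have "{} \<notin> M"
    using minimal minimal_left_ideal_imp_left_ideal
    by (auto simp: minimal_left_ideals_def left_ideal_def)
  moreover have "K = {}" if "K \<subseteq> A" "K \<subseteq> B" for K
    using disj that by blast
  ultimately have "?c A \<inter> ?c B = {}" by auto
  then have "card (?c A \<union> ?c B) = card (?c A) + card (?c B)"
    using finite_M by (intro card_Un_disjoint) auto
  \<comment> \<open>This is where the bound 4 enters: two components in each of \<open>A\<close> and
    \<open>B\<close> already exhaust \<open>M\<close>.\<close>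
  then have "card M \<le> card (?c A \<union> ?c B)"
    using two_le_card_components[OF A] two_le_card_components[OF B] card_M by linarith
  then have "?c A \<union> ?c B = M"
    using finite_M by (intro card_seteq) auto
  then have "\<Union>M \<subseteq> A \<union> B" by blast
  then show ?thesis using Union_M disj by blast
qed

lemma perfect_if_union_of_le_4_minimal_left_ideals:
  "perfect_graph (intersection_ideal_graph :: 'a set graph)"
  unfolding perfect_graph_def
proof (intro allI impI)
  fix W :: "'a set set" assume W: "W \<subseteq> fst intersection_ideal_graph"
  let ?G = "induced_subgraph intersection_ideal_graph W"
  define L where "L = {A \<in> W. \<not> minimal_left_ideal A}"
  define N where "N = {A \<in> W. minimal_left_ideal A}"
  have LN: "L \<union> N = W" by (auto simp: L_def N_def)
  have nt: "nontrivial_left_ideal A" if "A \<in> W" for A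
    using that W by (auto simp: intersection_ideal_graph_def)
  then have li: "left_ideal A" if "A \<in> W" for A
    using that by (simp add: nontrivial_left_ideal_def)
  then have "{} \<notin> W" by (auto simp: left_ideal_def)
  have G: "fst ?G = W" by (simp add: induced_subgraph_def)
  have edge: "{A, B} \<in> snd ?G \<longleftrightarrow> A \<noteq> B \<and> A \<inter> B \<noteq> {}" if "A \<in> W" "B \<in> W" for A B
  proof -
    have "{A, B} \<in> snd ?G \<longleftrightarrow> {A, B} \<in> snd intersection_ideal_graph"
      using that by (simp add: induced_subgraph_def)
    then show ?thesis
      using that nt by (simp add: intersection_ideal_graph_edge_iff)
  qed
  obtain K X and c :: "'a set \<Rightarrow> 'a set set" where
    K: "K \<subseteq> W" "finite K" "pairwise (\<lambda>A B. A \<inter> B \<noteq> {}) K"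
    and X: "finite X" "c ` W \<subseteq> X" "card X = card K"
    and c: "\<And>A B. A \<in> W \<Longrightarrow> B \<in> W \<Longrightarrow> A \<noteq> B \<Longrightarrow> A \<inter> B \<noteq> {} \<Longrightarrow> c A \<noteq> c B"
  \<comment> \<open>On \<open>W\<close>, adjacency means being distinct and meeting, so the clique
    and colouring obtained here are those of the induced subgraph.\<close>
  proof (rule optimal_intersection_coloring[of L N, unfolded LN])
    show "finite L"
      using finite_left_ideals by (rule rev_finite_subset) (auto simp: L_def li)
    show "{} \<notin> L" "{} \<notin> N" using \<open>{} \<notin> W\<close> LN by blast+
    show "B = - A" if "A \<in> L" "B \<in> L" "A \<inter> B = {}" for A B
      using that li by (intro disjoint_nonminimal_complementary) (auto simp: L_def)
    show "A \<inter> B = {}" if "A \<in> N" "B \<in> N" "A \<noteq> B" for A B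
      using that by (intro minimal_left_ideals_disjoint) (auto simp: N_def)
    show "T \<subseteq> A \<or> A \<inter> T = {}" if "A \<in> L" "T \<in> N" for A T
      using that li by (intro minimal_left_ideal_subset_or_disjoint) (auto simp: L_def N_def)
  qed (rule that)
  have "clique K (snd ?G)"
    using K(1,3) edge unfolding clique_def pairwise_def by blast
  moreover have "colorable ?G (card K)"
    using colorable_card[of X c ?G] X c edge unfolding G by metis
  ultimately show "clique_number ?G = chromatic_number ?G"
    using K(1,2) by (intro clique_number_eq_chromatic_number) (simp_all add: G)
qed

end

theorem theorem4p3:
  shows "(perfect_graph (intersection_ideal_graph :: 'a::semigroup_mult set graph) \<longrightarrow>
            finite (minimal_left_ideals :: 'a set set) \<and> card (minimal_left_ideals :: 'a set set) \<le> 4)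
       \<and> (\<forall>n. union_of_minimal_left_ideals TYPE('a) n \<longrightarrow>
            (perfect_graph (intersection_ideal_graph :: 'a set graph) \<longleftrightarrow> n \<le> 4))"
proof (intro conjI impI allI)
  fix n assume "union_of_minimal_left_ideals TYPE('a) n"
  then obtain M :: "'a set set" where M: "M \<subseteq> minimal_left_ideals" "finite M" "card M = n"
      "\<Union>M = UNIV"
    unfolding union_of_minimal_left_ideals_def by blast
  show "perfect_graph (intersection_ideal_graph :: 'a set graph) \<longleftrightarrow> n \<le> 4"
  proof
    assume "perfect_graph (intersection_ideal_graph :: 'a set graph)"
    \<comment> \<open>\<open>M\<close> is a subset of the set of all minimal left ideals, which has
      at most four elements.\<close>
    then show "n \<le> 4"
      using perfect_imp_card_minimal_left_ideals_le_4 card_mono[OF _ M(1)] M(3)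
      by (metis order_trans)
  next
    assume "n \<le> 4"
    then show "perfect_graph (intersection_ideal_graph :: 'a set graph)"
      using M perfect_if_union_of_le_4_minimal_left_ideals[of M] by simp
  qed
qed (simp_all add: perfect_imp_card_minimal_left_ideals_le_4)

end
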